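(* Consider the discrete-time linear system $x_{t+1}=Ax_t+Bu_t+v_t$ with $x_t\in\mathbb{R}^n$, $u_t\in\mathbb{R}^p$, where the disturbances $v_t\in\mathbb{R}^n$ are i.i.d. samples from a distribution $\mathcal{D}$ (of arbitrary form, with bounded moments). Let $Q,R$ be positive definite matrices, $\gamma\in(0,1)$, and let $K\in\mathbb{R}^{p\times n}$ be a feedback gain such that $A_K:=A+BK$ is stable. Set $Q_K:=Q+K^{\rm T}RK$ and let $P$ be the solution of the Lyapunov equation $P=Q+K^{\rm T}RK+\gamma A_K^{\rm T}PA_K$. For $x\in\mathbb{R}^n$ define the random variable $$G^{K}(x)=x^{\rm T}Px+2\sum_{k=0}^{\infty}\gamma^{k+1}w_k^{\rm T}PA_K^{k+1}x+\sum_{k=0}^{\infty}\gamma^{k+1}w_k^{\rm T}Pw_k+2\sum_{k=1}^{\infty}\gamma^{k+1}w_k^{\rm T}P\sum_{\tau=0}^{k-1}A_K^{k-\tau}w_\tau,$$ where $w_k\sim\mathcal{D}$, $k\in\mathbb{N}$, are mutually independent. Then $G^K(x)$ is a fixed-point solution of the random variable Bellman equation $$G^{K}(x)\overset{D}{=}x^{\rm T}Q_Kx+\gamma G^{K}(x'),\qquad x'=A_Kx+v_0,$$ where $v_0\sim\mathcal{D}$ is independent of the $w_k$'s and $\overset{D}{=}$ denotes equality in distribution.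
   Context: The random return of the static linear policy $u_t=Kx_t$ from $x_0=x$ is $\sum_{t=0}^\infty\gamma^t x_t^{\rm T}(Q+K^{\rm T}RK)x_t$; the theorem gives an explicit random variable satisfying its distributional Bellman equation. In $G^K(x')$ the state $x'$ is random and independent of the fresh copies $w_k$ used in the definition of $G^K$. *)

theory Defs
  imports "HOL-Analysis.Analysis" "HOL-Probability.Probability"
begin

text \<open>Matrix power (matrix product iterated; the componentwise monoid structure on vec is NOT used).\<close>
fun matpow :: "real^'n^'n \<Rightarrow> nat \<Rightarrow> real^'n^'n" where
  "matpow M 0 = mat 1"
| "matpow M (Suc k) = M ** matpow M k"

text \<open>Positive definite: symmetric with positive quadratic form on nonzero vectors.\<close>
definition pos_def :: "real^'n^'n \<Rightarrow> bool" where
  "pos_def M \<longleftrightarrow> transpose M = M \<and> (\<forall>x. x \<noteq> 0 \<longrightarrow> x \<bullet> (M *v x) > 0)"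

text \<open>(Schur) stability of a real square matrix: every (complex) eigenvalue has modulus < 1.\<close>
definition stable :: "real^'n^'n \<Rightarrow> bool" where
  "stable M \<longleftrightarrow> (\<forall>(l::complex) (v::complex^'n). v \<noteq> 0 \<longrightarrow>
       (\<chi> i j. complex_of_real (M $ i $ j)) *v v = l *s v \<longrightarrow> cmod l < 1)"

text \<open>The random return G^K(x), as a function of the i.i.d. sequence w = (w_0, w_1, ...).
  P is the Lyapunov solution, AK = A + B K.  The last sum runs over k >= 1 (reindexed k = j+1).\<close>
definition GK :: "real^'n^'n \<Rightarrow> real^'n^'n \<Rightarrow> real \<Rightarrow> real^'n \<Rightarrow> (nat \<Rightarrow> real^'n) \<Rightarrow> real" where
  "GK P AK \<gamma> x w =
     x \<bullet> (P *v x)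
   + 2 * (\<Sum>k. \<gamma>^(k+1) * (w k \<bullet> (P *v (matpow AK (k+1) *v x))))
   + (\<Sum>k. \<gamma>^(k+1) * (w k \<bullet> (P *v w k)))
   + 2 * (\<Sum>j. \<gamma>^((j+1)+1) * (w (j+1) \<bullet> (P *v (\<Sum>\<tau><j+1. matpow AK ((j+1) - \<tau>) *v w \<tau>))))"

end

(*
  Prepending a fresh noise v to the sequence w and splitting off the first term of each series
  gives the Bellman identity pointwise: G(x)(v, w_0, w_1, ...) = x^T Q_K x + gamma G(A_K x + v)(w).
  The tails are gamma times the series of G(A_K x + v)(w), the new noise v enters the cross terms
  through A_K^(k+1) v, and the Lyapunov equation absorbs the remaining quadratic terms (its
  solution P is automatically symmetric).  All series converge as soon as |w_k| <= c rho^k with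
  gamma rho^2 < 1, because the powers of the stable matrix A_K are bounded; almost every i.i.d.
  sequence grows this slowly, since the sum of |w_k| / rho^k has finite expectation.  As
  (v, w) |-> (v, w_0, w_1, ...) pushes D x D^N forward to D^N, the pointwise identity yields the
  equality in distribution.
*)
theory Submission
  imports Defs "Jordan_Normal_Form.Spectral_Radius"
begin

no_notation Matrix.vec_index (infixl "$" 100)
no_notation Matrix.scalar_prod (infix "\<bullet>" 70)

lemma matpow_Suc_right: "matpow M (Suc k) = matpow M k ** M"
  by (induction k) (simp_all add: matrix_mul_assoc)

lemma matpow_mult_vec_Suc: "matpow M k *v (M *v y) = matpow M (Suc k) *v y"
  by (simp only: matpow_Suc_right matrix_vector_mul_assoc)

text \<open>The bound on the powers of a matrix of spectral radius below 1 lives in the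
  Jordan normal form library, whose matrices are indexed by \<open>{..<n}\<close>; \<open>h\<close> enumerates the index type.\<close>

definition cart_to_jnf :: "(nat \<Rightarrow> 'n) \<Rightarrow> real^'n^'n \<Rightarrow> complex mat" where
  "cart_to_jnf h X = Matrix.mat CARD('n) CARD('n) (\<lambda>(i, j). complex_of_real (X $ h i $ h j))"

lemma cart_to_jnf_carrier: "cart_to_jnf (h :: nat \<Rightarrow> 'n::finite) X \<in> carrier_mat CARD('n) CARD('n)"
  by (simp add: cart_to_jnf_def)

lemma dim_cart_to_jnf [simp]:
  fixes h :: "nat \<Rightarrow> 'n::finite"
  shows "dim_row (cart_to_jnf h X) = CARD('n)" "dim_col (cart_to_jnf h X) = CARD('n)"
  by (simp_all add: cart_to_jnf_def)

context
  fixes h :: "nat \<Rightarrow> 'n::finite"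
  assumes h: "bij_betw h {..<CARD('n)} UNIV"
begin

lemma cart_to_jnf_mult: "cart_to_jnf h (X ** Y) = cart_to_jnf h X * cart_to_jnf h Y"
proof (rule eq_matI)
  fix i j assume "i < dim_row (cart_to_jnf h X * cart_to_jnf h Y)"
    and "j < dim_col (cart_to_jnf h X * cart_to_jnf h Y)"
  then have i: "i < CARD('n)" and j: "j < CARD('n)"
    by (simp_all add: cart_to_jnf_def)
  have "(cart_to_jnf h X * cart_to_jnf h Y) $$ (i, j)
      = (\<Sum>k<CARD('n). complex_of_real (X $ h i $ h k) * complex_of_real (Y $ h k $ h j))"
    using i j by (simp add: cart_to_jnf_def scalar_prod_def atLeast0LessThan)
  also have "\<dots> = (\<Sum>b\<in>UNIV. complex_of_real (X $ h i $ b) * complex_of_real (Y $ b $ h j))"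
    by (rule sum.reindex_bij_betw[OF h])
  finally show "cart_to_jnf h (X ** Y) $$ (i, j) = (cart_to_jnf h X * cart_to_jnf h Y) $$ (i, j)"
    using i j by (simp add: cart_to_jnf_def matrix_matrix_mult_def)
qed (simp_all add: cart_to_jnf_def)

lemma cart_to_jnf_one: "cart_to_jnf h (Finite_Cartesian_Product.mat 1) = 1\<^sub>m CARD('n)"
proof (rule eq_matI)
  fix i j assume "i < dim_row (1\<^sub>m CARD('n) :: complex mat)" "j < dim_col (1\<^sub>m CARD('n) :: complex mat)"
  then have "i \<in> {..<CARD('n)}" "j \<in> {..<CARD('n)}" by auto
  moreover from this have "h i = h j \<longleftrightarrow> i = j"
    using h by (auto simp: bij_betw_def inj_on_def)
  ultimately show "cart_to_jnf h (Finite_Cartesian_Product.mat 1) $$ (i, j) = 1\<^sub>m CARD('n) $$ (i, j)"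
    by (simp add: cart_to_jnf_def Finite_Cartesian_Product.mat_def)
qed (simp_all add: cart_to_jnf_def)

lemma cart_to_jnf_matpow: "cart_to_jnf h (matpow M k) = cart_to_jnf h M ^\<^sub>m k"
proof (induction k)
  case (Suc k)
  then show ?case by (simp only: matpow_Suc_right cart_to_jnf_mult pow_mat.simps)
qed (simp add: cart_to_jnf_one)

lemma cart_to_jnf_eigenvalue:
  assumes "eigenvalue (cart_to_jnf h M) l"
  shows "\<exists>u. u \<noteq> 0 \<and> (\<chi> i j. complex_of_real (M $ i $ j)) *v u = l *s u"
proof -
  define g where "g = inv_into {..<CARD('n)} h"
  have hg: "h (g a) = a" for a
    using bij_betw_inv_into_right[OF h] by (simp add: g_def)
  have g: "g a < CARD('n)" for a
    using bij_betw_apply[OF bij_betw_inv_into[OF h]] by (simp add: g_def)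
  have gh: "g (h i) = i" if "i < CARD('n)" for i
    using h that unfolding g_def by (simp add: bij_betw_inv_into_left)
  obtain v where v: "v \<in> carrier_vec CARD('n)" "v \<noteq> 0\<^sub>v CARD('n)" "cart_to_jnf h M *\<^sub>v v = l \<cdot>\<^sub>v v"
    using assms unfolding eigenvalue_def eigenvector_def by auto
  define u :: "complex^'n" where "u = (\<chi> a. Matrix.vec_index v (g a))"
  have "u \<noteq> 0"
  proof
    assume "u = 0"
    have "Matrix.vec_index v i = u $ h i" if "i < CARD('n)" for i
      by (simp add: u_def gh[OF that])
    with \<open>u = 0\<close> have "Matrix.vec_index v i = 0" if "i < CARD('n)" for i
      using that by simp
    with v(1,2) show False by (auto intro: eq_vecI)
  qed
  moreover have "(\<chi> i j. complex_of_real (M $ i $ j)) *v u = l *s u"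
  proof (rule Finite_Cartesian_Product.vec_eq_iff[THEN iffD2], rule allI)
    fix a
    have "(l *s u) $ a = Matrix.vec_index (cart_to_jnf h M *\<^sub>v v) (g a)"
      using v g[of a] by (simp add: u_def)
    also have "\<dots> = (\<Sum>k<CARD('n). complex_of_real (M $ a $ h k) * Matrix.vec_index v (g (h k)))"
      using g[of a] v(1) gh hg by (auto simp: cart_to_jnf_def scalar_prod_def atLeast0LessThan)
    also have "\<dots> = (\<Sum>b\<in>UNIV. complex_of_real (M $ a $ b) * Matrix.vec_index v (g b))"
      by (rule sum.reindex_bij_betw[OF h])
    finally show "((\<chi> i j. complex_of_real (M $ i $ j)) *v u) $ a = (l *s u) $ a"
      by (simp add: matrix_vector_mult_def u_def)
  qed
  ultimately show ?thesis by blast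
qed

end

lemma stable_matpow_entries_bounded:
  fixes M :: "real^'n^'n"
  assumes "stable M"
  shows "\<exists>c. \<forall>k i j. \<bar>matpow M k $ i $ j\<bar> \<le> c"
proof -
  obtain h :: "nat \<Rightarrow> 'n" where h: "bij_betw h {..<CARD('n)} UNIV"
    using ex_bij_betw_nat_finite[of "UNIV :: 'n set"] by (auto simp: atLeast0LessThan)
  obtain l where "l \<in> spectrum (cart_to_jnf h M)" and radius: "spectral_radius (cart_to_jnf h M) = cmod l"
    using spectral_radius_mem_max(1)[OF cart_to_jnf_carrier] by auto
  then have "eigenvalue (cart_to_jnf h M) l"
    by (simp add: spectrum_def)
  then obtain u where "u \<noteq> 0" "(\<chi> i j. complex_of_real (M $ i $ j)) *v u = l *s u"
    using cart_to_jnf_eigenvalue[OF h] by blast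
  then have "spectral_radius (cart_to_jnf h M) < 1"
    using assms[unfolded stable_def, rule_format] radius by simp
  then obtain c where c: "\<And>k. norm_bound (cart_to_jnf h M ^\<^sub>m k) c"
    using spectral_radius_jnf_norm_bound_less_1_upper_triangular[OF cart_to_jnf_carrier] by blast
  have "\<bar>matpow M k $ a $ b\<bar> \<le> c" for k a b
  proof -
    have "a \<in> h ` {..<CARD('n)}" "b \<in> h ` {..<CARD('n)}"
      using bij_betw_imp_surj_on[OF h] by auto
    then obtain i j where "i < CARD('n)" "j < CARD('n)" "h i = a" "h j = b"
      by blast
    then have "cmod (cart_to_jnf h (matpow M k) $$ (i, j)) \<le> c"
      using c[of k] unfolding norm_bound_def cart_to_jnf_matpow[OF h] by simp
    with \<open>h i = a\<close> \<open>h j = b\<close> \<open>i < CARD('n)\<close> \<open>j < CARD('n)\<close> show ?thesis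
      by (simp add: cart_to_jnf_def)
  qed
  then show ?thesis by blast
qed

lemma stable_matpow_bounded:
  fixes M :: "real^'n^'n"
  assumes "stable M"
  obtains C where "C \<ge> 0" and "\<And>k y. norm (matpow M k *v y) \<le> C * norm y"
proof -
  obtain c where c: "\<And>k i j. \<bar>matpow M k $ i $ j\<bar> \<le> c"
    using stable_matpow_entries_bounded[OF assms] by blast
  define C where "C = real CARD('n) * real CARD('n) * c"
  have bound: "norm (matpow M k *v y) \<le> C * norm y" for k y
    using onorm[OF matrix_vector_mul_bounded_linear, of "matpow M k" y]
      onorm_le_matrix_component[OF c, of k] unfolding C_def
    by (meson mult_right_mono norm_ge_zero order_trans)
  have "C \<ge> 0"
    using c[of 0] unfolding C_def by (meson abs_ge_zero order_trans mult_nonneg_nonneg of_nat_0_le_iff)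
  from this bound show thesis by (rule that)
qed

lemma inner_transpose_mult_vec: "(y::real^'n) \<bullet> (transpose M *v z) = (M *v y) \<bullet> z"
proof -
  have "y \<bullet> (transpose M *v z) = (z v* M) \<bullet> y"
    by (simp add: inner_commute)
  also have "\<dots> = z \<bullet> (M *v y)"
    by (rule dot_lmul_matrix)
  finally show ?thesis
    by (simp add: inner_commute)
qed

lemma symmetric_matrix_inner_commute:
  "transpose M = M \<Longrightarrow> (y::real^'n) \<bullet> (M *v z) = z \<bullet> (M *v y)"
  by (metis inner_commute inner_transpose_mult_vec)

lemma transpose_add: "transpose (M + N) = transpose M + transpose N"
  by (simp add: transpose_def Finite_Cartesian_Product.vec_eq_iff)

lemma inner_mult_vec_le_onorm: "\<bar>(y::real^'n) \<bullet> (M *v z)\<bar> \<le> onorm ((*v) M) * (norm y * norm z)"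
proof -
  have "\<bar>y \<bullet> (M *v z)\<bar> \<le> norm y * norm (M *v z)"
    by (rule Cauchy_Schwarz_ineq2)
  also have "\<dots> \<le> norm y * (onorm ((*v) M) * norm z)"
    by (intro mult_left_mono onorm matrix_vector_mul_bounded_linear) simp
  finally show ?thesis by (simp add: mult_ac)
qed

lemma lyapunov_inner:
  fixes P Q L :: "real^'n^'n"
  assumes "P = Q + \<gamma> *\<^sub>R (transpose L ** P ** L)"
  shows "y \<bullet> (P *v z) = y \<bullet> (Q *v z) + \<gamma> * ((L *v y) \<bullet> (P *v (L *v z)))"
proof -
  have "P *v z = Q *v z + \<gamma> *\<^sub>R (transpose L *v (P *v (L *v z)))"
    by (subst assms) (simp only: matrix_vector_mult_add_rdistrib
        scaleR_matrix_vector_assoc[symmetric] matrix_vector_mul_assoc matrix_mul_assoc)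
  then show ?thesis
    by (simp only: inner_add_right inner_scaleR_right inner_transpose_mult_vec)
qed

text \<open>The antisymmetric part of \<open>P\<close> satisfies \<open>asym y z = \<gamma>^k * asym (L^k y) (L^k z)\<close>,
  which tends to 0.\<close>

lemma lyapunov_solution_inner_commute:
  fixes P Q L :: "real^'n^'n"
  assumes lyap: "P = Q + \<gamma> *\<^sub>R (transpose L ** P ** L)" and "transpose Q = Q"
    and \<gamma>: "0 \<le> \<gamma>" "\<gamma> < 1"
    and "0 \<le> C" and L_bounded: "\<And>k y. norm (matpow L k *v y) \<le> C * norm y"
  shows "y \<bullet> (P *v z) = z \<bullet> (P *v y)"
proof -
  define asym where "asym y z = y \<bullet> (P *v z) - z \<bullet> (P *v y)" for y z
  have asym_step: "asym y z = \<gamma> * asym (L *v y) (L *v z)" for y z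
    using lyapunov_inner[OF lyap, of y z] lyapunov_inner[OF lyap, of z y]
      symmetric_matrix_inner_commute[OF \<open>transpose Q = Q\<close>, of y z]
    by (simp add: asym_def algebra_simps)
  have asym_iter: "asym y z = \<gamma>^k * asym (matpow L k *v y) (matpow L k *v z)" for k
  proof (induction k arbitrary: y z)
    case (Suc k)
    show ?case
      using asym_step[of y z] Suc[of "L *v y" "L *v z"] by (simp add: matpow_mult_vec_Suc)
  qed (simp add: matrix_vector_mul_lid)
  define B where "B = 2 * onorm ((*v) P) * ((C * norm y) * (C * norm z))"
  have "\<bar>asym y z\<bar> \<le> B * \<gamma>^k" for k
  proof -
    let ?y = "matpow L k *v y" and ?z = "matpow L k *v z"
    have "\<bar>asym ?y ?z\<bar> \<le> onorm ((*v) P) * (norm ?y * norm ?z) + onorm ((*v) P) * (norm ?z * norm ?y)"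
      unfolding asym_def by (intro abs_triangle_ineq4[THEN order_trans] add_mono inner_mult_vec_le_onorm)
    also have "\<dots> = 2 * onorm ((*v) P) * (norm ?y * norm ?z)"
      by (simp add: mult_ac)
    also have "\<dots> \<le> B"
      unfolding B_def using \<open>0 \<le> C\<close> onorm_pos_le[OF matrix_vector_mul_bounded_linear, of P]
      by (intro mult_left_mono mult_mono L_bounded) auto
    finally have "\<gamma>^k * \<bar>asym ?y ?z\<bar> \<le> \<gamma>^k * B"
      using \<gamma> by (simp add: mult_left_mono)
    then show ?thesis
      using asym_iter[of k] \<gamma> by (simp add: abs_mult mult.commute)
  qed
  moreover have "(\<lambda>k. B * \<gamma>^k) \<longlonglongrightarrow> 0"
    using \<gamma> by (intro tendsto_mult_right_zero LIMSEQ_power_zero) simp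
  ultimately have "\<bar>asym y z\<bar> \<le> 0"
    by (intro LIMSEQ_le_const) auto
  then show ?thesis by (simp add: asym_def)
qed

definition state_series ::
    "real^'n^'n \<Rightarrow> real^'n^'n \<Rightarrow> real \<Rightarrow> real^'n \<Rightarrow> (nat \<Rightarrow> real^'n) \<Rightarrow> real" where
  "state_series P L \<gamma> y w = (\<Sum>k. \<gamma>^(k+1) * (w k \<bullet> (P *v (matpow L (k+1) *v y))))"

definition noise_series :: "real^'n^'n \<Rightarrow> real \<Rightarrow> (nat \<Rightarrow> real^'n) \<Rightarrow> real" where
  "noise_series P \<gamma> w = (\<Sum>k. \<gamma>^(k+1) * (w k \<bullet> (P *v w k)))"

definition cross_series :: "real^'n^'n \<Rightarrow> real^'n^'n \<Rightarrow> real \<Rightarrow> (nat \<Rightarrow> real^'n) \<Rightarrow> real" where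
  "cross_series P L \<gamma> w =
     (\<Sum>j. \<gamma>^((j+1)+1) * (w (j+1) \<bullet> (P *v (\<Sum>\<tau><j+1. matpow L ((j+1) - \<tau>) *v w \<tau>))))"

lemma GK_eq_series:
  "GK P L \<gamma> x w =
     x \<bullet> (P *v x) + 2 * state_series P L \<gamma> x w + noise_series P \<gamma> w + 2 * cross_series P L \<gamma> w"
  by (simp add: GK_def state_series_def noise_series_def cross_series_def)

lemma suminf_eq_first_plus_tail:
  fixes f :: "nat \<Rightarrow> real"
  assumes "summable (\<lambda>k. f (Suc k))"
  shows "suminf f = f 0 + (\<Sum>k. f (Suc k))"
  using suminf_split_head[of f] assms by (simp add: summable_Suc_iff)

lemma state_series_case_nat:
  assumes "summable (\<lambda>k. \<gamma>^(k+1) * (w k \<bullet> (P *v (matpow L (k+1) *v (L *v x)))))"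
  shows "state_series P L \<gamma> x (case_nat v w)
       = \<gamma> * (v \<bullet> (P *v (L *v x))) + \<gamma> * state_series P L \<gamma> (L *v x) w"
proof -
  have shift: "\<gamma>^(Suc k + 1) * (case_nat v w (Suc k) \<bullet> (P *v (matpow L (Suc k + 1) *v x)))
      = \<gamma> * (\<gamma>^(k+1) * (w k \<bullet> (P *v (matpow L (k+1) *v (L *v x)))))" for k
    by (simp add: matpow_mult_vec_Suc del: matpow.simps)
  show ?thesis
    unfolding state_series_def
    by (subst suminf_eq_first_plus_tail) (simp_all only: shift summable_mult assms suminf_mult,
        simp add: matrix_mul_rid)
qed

lemma state_series_add:
  assumes "summable (\<lambda>k. \<gamma>^(k+1) * (w k \<bullet> (P *v (matpow L (k+1) *v y))))"
    and "summable (\<lambda>k. \<gamma>^(k+1) * (w k \<bullet> (P *v (matpow L (k+1) *v z))))"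
  shows "state_series P L \<gamma> (y + z) w = state_series P L \<gamma> y w + state_series P L \<gamma> z w"
  unfolding state_series_def using suminf_add[OF assms]
  by (simp add: matrix_vector_right_distrib inner_add_right distrib_left)

lemma noise_series_case_nat:
  assumes "summable (\<lambda>k. \<gamma>^(k+1) * (w k \<bullet> (P *v w k)))"
  shows "noise_series P \<gamma> (case_nat v w) = \<gamma> * (v \<bullet> (P *v v)) + \<gamma> * noise_series P \<gamma> w"
proof -
  have shift: "\<gamma>^(Suc k + 1) * (case_nat v w (Suc k) \<bullet> (P *v case_nat v w (Suc k)))
      = \<gamma> * (\<gamma>^(k+1) * (w k \<bullet> (P *v w k)))" for k
    by simp
  show ?thesis
    unfolding noise_series_def
    by (subst suminf_eq_first_plus_tail) (simp_all only: shift summable_mult assms suminf_mult, simp)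
qed

lemma cross_series_case_nat:
  assumes state: "summable (\<lambda>k. \<gamma>^(k+1) * (w k \<bullet> (P *v (matpow L (k+1) *v v))))"
    and cross: "summable (\<lambda>j. \<gamma>^((j+1)+1) * (w (j+1) \<bullet> (P *v (\<Sum>\<tau><j+1. matpow L ((j+1) - \<tau>) *v w \<tau>))))"
  shows "cross_series P L \<gamma> (case_nat v w) = \<gamma> * state_series P L \<gamma> v w + \<gamma> * cross_series P L \<gamma> w"
proof -
  \<comment> \<open>the part of the shifted cross terms not involving \<open>v\<close>; \<open>e 0 = 0\<close>\<close>
  define e where "e j = \<gamma>^(j+2) * (w j \<bullet> (P *v (\<Sum>\<tau><j. matpow L (j - \<tau>) *v w \<tau>)))" for j
  have split: "\<gamma>^((j+1)+1) * (case_nat v w (j+1) \<bullet> (P *v (\<Sum>\<tau><j+1. matpow L ((j+1) - \<tau>) *v case_nat v w \<tau>)))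
      = \<gamma> * (\<gamma>^(j+1) * (w j \<bullet> (P *v (matpow L (j+1) *v v)))) + e j" for j
    by (simp add: e_def sum.lessThan_Suc_shift matrix_vector_right_distrib inner_add_right
        distrib_left mult_ac del: sum.lessThan_Suc)
  have e_Suc: "e (Suc j)
      = \<gamma> * (\<gamma>^((j+1)+1) * (w (j+1) \<bullet> (P *v (\<Sum>\<tau><j+1. matpow L ((j+1) - \<tau>) *v w \<tau>))))" for j
    by (simp add: e_def mult_ac)
  have e_summable: "summable (\<lambda>j. e (Suc j))"
    unfolding e_Suc using cross by (rule summable_mult)
  have "suminf e = \<gamma> * cross_series P L \<gamma> w"
    using suminf_eq_first_plus_tail[OF e_summable] cross
    by (simp only: e_Suc suminf_mult cross_series_def) (simp add: e_def)
  have "summable e"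
    using e_summable by (simp add: summable_Suc_iff)
  have "cross_series P L \<gamma> (case_nat v w)
      = (\<Sum>j. \<gamma> * (\<gamma>^(j+1) * (w j \<bullet> (P *v (matpow L (j+1) *v v)))) + e j)"
    unfolding cross_series_def split ..
  also have "\<dots> = \<gamma> * state_series P L \<gamma> v w + suminf e"
    unfolding state_series_def suminf_mult[OF state, symmetric]
    using summable_mult[OF state, of \<gamma>] \<open>summable e\<close> by (rule suminf_add[symmetric])
  finally show ?thesis
    using \<open>suminf e = \<gamma> * cross_series P L \<gamma> w\<close> by simp
qed

lemma GK_case_nat:
  fixes P Q L :: "real^'n^'n"
  assumes P_sym: "\<And>y z. y \<bullet> (P *v z) = z \<bullet> (P *v y)"
    and lyap: "\<And>y. y \<bullet> (P *v y) = y \<bullet> (Q *v y) + \<gamma> * ((L *v y) \<bullet> (P *v (L *v y)))"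
    and state: "\<And>y. summable (\<lambda>k. \<gamma>^(k+1) * (w k \<bullet> (P *v (matpow L (k+1) *v y))))"
    and noise: "summable (\<lambda>k. \<gamma>^(k+1) * (w k \<bullet> (P *v w k)))"
    and cross: "summable (\<lambda>j. \<gamma>^((j+1)+1) * (w (j+1) \<bullet> (P *v (\<Sum>\<tau><j+1. matpow L ((j+1) - \<tau>) *v w \<tau>))))"
  shows "GK P L \<gamma> x (case_nat v w) = x \<bullet> (Q *v x) + \<gamma> * GK P L \<gamma> (L *v x + v) w"
proof -
  have "(L *v x + v) \<bullet> (P *v (L *v x + v))
      = (L *v x) \<bullet> (P *v (L *v x)) + 2 * (v \<bullet> (P *v (L *v x))) + v \<bullet> (P *v v)"
    using P_sym[of "L *v x" v] by (simp add: matrix_vector_right_distrib inner_add_left inner_add_right)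
  then show ?thesis
    unfolding GK_eq_series
    using state_series_case_nat[OF state] state_series_add[OF state state]
      noise_series_case_nat[OF noise] cross_series_case_nat[OF state cross] lyap[of x]
    by (simp add: algebra_simps)
qed

lemma summable_Suc_mult_power:
  fixes q :: real
  assumes "\<bar>q\<bar> < 1"
  shows "summable (\<lambda>n. real (Suc n) * q^n)"
  using termdiff_converges[of q 1 "\<lambda>_. 1"] assms by (simp add: diffs_def)

lemma abs_power_mult_inner_le:
  fixes P :: "real^'n^'n"
  assumes "0 \<le> \<gamma>" and "norm a \<le> A" and "norm b \<le> B"
  shows "\<bar>\<gamma>^m * (a \<bullet> (P *v b))\<bar> \<le> \<gamma>^m * (onorm ((*v) P) * (A * B))"
proof -
  have "0 \<le> A"
    using norm_ge_zero[of a] assms(2) by linarith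
  have "\<bar>a \<bullet> (P *v b)\<bar> \<le> onorm ((*v) P) * (norm a * norm b)"
    by (rule inner_mult_vec_le_onorm)
  also have "\<dots> \<le> onorm ((*v) P) * (A * B)"
    using assms \<open>0 \<le> A\<close> onorm_pos_le[OF matrix_vector_mul_bounded_linear, of P]
    by (intro mult_left_mono mult_mono) auto
  finally show ?thesis
    using assms(1) by (simp add: abs_mult mult_left_mono)
qed

context
  fixes P L :: "real^'n^'n" and \<gamma> \<rho> C c :: real and w :: "nat \<Rightarrow> real^'n"
  assumes \<gamma>: "0 \<le> \<gamma>" and \<rho>: "1 \<le> \<rho>" "\<gamma> * \<rho>^2 < 1"
    and C: "0 \<le> C" and L_bounded: "\<And>k y. norm (matpow L k *v y) \<le> C * norm y"
    and w_growth: "\<And>k. norm (w k) \<le> c * \<rho>^k"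
begin

private lemma c_nonneg: "0 \<le> c"
  using w_growth[of 0] norm_ge_zero[of "w 0"] by (simp del: norm_ge_zero)

private lemma summable_ratio_powers: "summable (\<lambda>k. (\<gamma> * \<rho>^2)^k)"
  using \<gamma> \<rho> by (intro summable_geometric) simp

lemma summable_state_terms: "summable (\<lambda>k. \<gamma>^(k+1) * (w k \<bullet> (P *v (matpow L (k+1) *v y))))"
proof (rule summable_comparison_test'[OF summable_mult[OF summable_ratio_powers]])
  fix k :: nat
  have "\<bar>\<gamma>^(k+1) * (w k \<bullet> (P *v (matpow L (k+1) *v y)))\<bar>
      \<le> \<gamma>^(k+1) * (onorm ((*v) P) * ((c * \<rho>^k) * (C * norm y)))"
    by (intro abs_power_mult_inner_le \<gamma> w_growth L_bounded)
  also have "\<dots> = (\<gamma> * onorm ((*v) P) * c * C * norm y) * (\<gamma> * \<rho>)^k"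
    by (simp add: power_mult_distrib mult_ac)
  also have "\<dots> \<le> (\<gamma> * onorm ((*v) P) * c * C * norm y) * (\<gamma> * \<rho>^2)^k"
  proof (rule mult_left_mono[OF power_mono])
    show "\<gamma> * \<rho> \<le> \<gamma> * \<rho>^2"
      using \<gamma> \<rho> mult_right_mono[of 1 \<rho> \<rho>] by (intro mult_left_mono) (auto simp: power2_eq_square)
    show "0 \<le> \<gamma> * onorm ((*v) P) * c * C * norm y"
      using \<gamma> C c_nonneg onorm_pos_le[OF matrix_vector_mul_bounded_linear, of P] by simp
  qed (use \<gamma> \<rho> in auto)
  finally show "norm (\<gamma>^(k+1) * (w k \<bullet> (P *v (matpow L (k+1) *v y))))
      \<le> (\<gamma> * onorm ((*v) P) * c * C * norm y) * (\<gamma> * \<rho>^2)^k"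
    by simp
qed

lemma summable_noise_terms: "summable (\<lambda>k. \<gamma>^(k+1) * (w k \<bullet> (P *v w k)))"
proof (rule summable_comparison_test'[OF summable_mult[OF summable_ratio_powers]])
  fix k :: nat
  have "\<bar>\<gamma>^(k+1) * (w k \<bullet> (P *v w k))\<bar>
      \<le> \<gamma>^(k+1) * (onorm ((*v) P) * ((c * \<rho>^k) * (c * \<rho>^k)))"
    by (intro abs_power_mult_inner_le \<gamma> w_growth)
  also have "\<dots> = (\<gamma> * onorm ((*v) P) * c^2) * (\<gamma> * \<rho>^2)^k"
    by (simp add: power_mult_distrib power2_eq_square power_mult mult_ac)
  finally show "norm (\<gamma>^(k+1) * (w k \<bullet> (P *v w k))) \<le> (\<gamma> * onorm ((*v) P) * c^2) * (\<gamma> * \<rho>^2)^k"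
    by simp
qed

lemma summable_cross_terms:
  "summable (\<lambda>j. \<gamma>^((j+1)+1) * (w (j+1) \<bullet> (P *v (\<Sum>\<tau><j+1. matpow L ((j+1) - \<tau>) *v w \<tau>))))"
proof (rule summable_comparison_test'[OF summable_mult[OF summable_Suc_mult_power]])
  show "\<bar>\<gamma> * \<rho>^2\<bar> < 1" using \<gamma> \<rho> by simp
  fix j :: nat
  have "norm (\<Sum>\<tau><j+1. matpow L ((j+1) - \<tau>) *v w \<tau>) \<le> (\<Sum>\<tau><j+1. C * (c * \<rho>^j))"
  proof (intro norm_sum[THEN order_trans] sum_mono)
    fix \<tau> assume "\<tau> \<in> {..<j+1}"
    have "\<rho>^\<tau> \<le> \<rho>^j"
      using \<open>\<tau> \<in> {..<j+1}\<close> \<rho> by (intro power_increasing) auto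
    then have "norm (w \<tau>) \<le> c * \<rho>^j"
      using w_growth[of \<tau>] c_nonneg by (meson mult_left_mono order_trans)
    then show "norm (matpow L ((j+1) - \<tau>) *v w \<tau>) \<le> C * (c * \<rho>^j)"
      using L_bounded C by (meson mult_left_mono order_trans)
  qed
  then have "\<bar>\<gamma>^((j+1)+1) * (w (j+1) \<bullet> (P *v (\<Sum>\<tau><j+1. matpow L ((j+1) - \<tau>) *v w \<tau>)))\<bar>
      \<le> \<gamma>^((j+1)+1) * (onorm ((*v) P) * ((c * \<rho>^(j+1)) * (real (j+1) * (C * (c * \<rho>^j)))))"
    by (intro abs_power_mult_inner_le \<gamma> w_growth) simp
  also have "\<dots> = (\<gamma>^2 * \<rho> * onorm ((*v) P) * c^2 * C) * (real (Suc j) * (\<gamma> * \<rho>^2)^j)"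
    by (simp add: power_mult_distrib power2_eq_square power_mult mult_ac)
  finally show "norm (\<gamma>^((j+1)+1) * (w (j+1) \<bullet> (P *v (\<Sum>\<tau><j+1. matpow L ((j+1) - \<tau>) *v w \<tau>))))
      \<le> (\<gamma>^2 * \<rho> * onorm ((*v) P) * c^2 * C) * (real (Suc j) * (\<gamma> * \<rho>^2)^j)"
    by simp
qed

lemma GK_case_nat_geometric_growth:
  assumes lyap: "P = Q + \<gamma> *\<^sub>R (transpose L ** P ** L)" and "transpose Q = Q"
  shows "GK P L \<gamma> x (case_nat v w) = x \<bullet> (Q *v x) + \<gamma> * GK P L \<gamma> (L *v x + v) w"
proof -
  have "\<gamma> < 1"
    using \<gamma> \<rho> mult_left_mono[of 1 "\<rho>^2" \<gamma>] by (simp add: one_le_power)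
  note P_sym = lyapunov_solution_inner_commute[OF lyap \<open>transpose Q = Q\<close> \<gamma> \<open>\<gamma> < 1\<close> C L_bounded]
  show ?thesis
    by (rule GK_case_nat[OF P_sym lyapunov_inner[OF lyap]
          summable_state_terms summable_noise_terms summable_cross_terms])
qed

end

lemma ex_gt_1_mult_power2_lt_1:
  fixes \<gamma> :: real
  assumes "\<gamma> < 1"
  obtains \<rho> where "1 < \<rho>" and "\<gamma> * \<rho>^2 < 1"
proof (cases "\<gamma> \<le> 0")
  case True
  then show thesis
    using that[of 2] by (simp add: mult_nonpos_nonneg)
next
  case False
  have "0 < (1 - \<gamma>)^2"
    using assms by simp
  then have "4 * \<gamma> < (1 + \<gamma>)^2"
    by (simp add: power2_eq_square algebra_simps)
  then show thesis
    using that[of "2 / (1 + \<gamma>)"] False assms by (simp add: power_divide field_simps)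
qed

lemma AE_PiM_norm_le_geometric:
  fixes D :: "'a::real_normed_vector measure"
  assumes D: "prob_space D" and norm_integrable: "integrable D norm" and "1 < \<rho>"
  shows "AE w in PiM UNIV (\<lambda>_::nat. D). \<exists>c. \<forall>k. norm (w k) \<le> c * \<rho>^k"
proof -
  interpret sequence_space D
    unfolding sequence_space_def by (rule product_prob_spaceI) (rule D)
  let ?Pi = "PiM UNIV (\<lambda>_::nat. D)"
  define F where "F w = (\<Sum>k. ennreal (norm (w k) / \<rho>^k))" for w :: "nat \<Rightarrow> 'a"
  have [measurable]: "norm \<in> borel_measurable D"
    using norm_integrable by (rule borel_measurable_integrable)
  then have ennreal_norm_measurable: "(\<lambda>v. ennreal (norm v)) \<in> borel_measurable D"
    by measurable
  have component_measurable[measurable]: "(\<lambda>w. w k) \<in> measurable ?Pi D" for k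
    by (rule measurable_component_singleton) simp
  have integral_term: "(\<integral>\<^sup>+w. ennreal (norm (w k) / \<rho>^k) \<partial>?Pi)
      = ennreal ((1/\<rho>)^k) * (\<integral>\<^sup>+v. ennreal (norm v) \<partial>D)" for k
  proof -
    have "(\<integral>\<^sup>+w. ennreal (norm (w k) / \<rho>^k) \<partial>?Pi)
        = (\<integral>\<^sup>+w. ennreal ((1/\<rho>)^k) * ennreal (norm (w k)) \<partial>?Pi)"
      using \<open>1 < \<rho>\<close> by (simp add: ennreal_mult[symmetric] power_one_over field_simps)
    also have "\<dots> = ennreal ((1/\<rho>)^k) * (\<integral>\<^sup>+w. ennreal (norm (w k)) \<partial>?Pi)"
      by (rule nn_integral_cmult) measurable
    also have "(\<integral>\<^sup>+w. ennreal (norm (w k)) \<partial>?Pi)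
        = (\<integral>\<^sup>+v. ennreal (norm v) \<partial>distr ?Pi D (\<lambda>w. w k))"
      by (rule nn_integral_distr[symmetric]) (simp_all add: component_measurable ennreal_norm_measurable)
    also have "distr ?Pi D (\<lambda>w. w k) = D"
      by (rule distr_PiM_component) (auto simp: D)
    finally show ?thesis .
  qed
  have "(\<integral>\<^sup>+w. F w \<partial>?Pi) = (\<Sum>k. ennreal ((1/\<rho>)^k)) * (\<integral>\<^sup>+v. ennreal (norm v) \<partial>D)"
    unfolding F_def by (subst nn_integral_suminf) (auto simp: integral_term)
  also have "\<dots> = ennreal (\<Sum>k. (1/\<rho>)^k) * (\<integral>\<^sup>+v. ennreal (norm v) \<partial>D)"
    using \<open>1 < \<rho>\<close> by (subst suminf_ennreal2) auto
  also have "\<dots> < \<infinity>"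
    using norm_integrable unfolding integrable_iff_bounded by (simp add: ennreal_mult_less_top)
  finally have "AE w in ?Pi. F w \<noteq> \<infinity>"
    by (intro nn_integral_PInf_AE) (auto simp: F_def)
  then show ?thesis
  proof eventually_elim
    case (elim w)
    have "summable (\<lambda>k. norm (w k) / \<rho>^k)"
      using elim \<open>1 < \<rho>\<close> by (intro summable_suminf_not_top) (auto simp: F_def)
    then have "norm (w k) / \<rho>^k \<le> (\<Sum>k. norm (w k) / \<rho>^k)" for k
      using \<open>1 < \<rho>\<close> by (intro sum_le_suminf[of _ "{k}", simplified]) auto
    then have "norm (w k) \<le> (\<Sum>k. norm (w k) / \<rho>^k) * \<rho>^k" for k
      using \<open>1 < \<rho>\<close> by (simp add: field_simps)
    then show ?case by blast
  qed
qed

lemma distr_PiM_eq_distr_case_nat: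
  fixes D :: "'a measure" and G :: "(nat \<Rightarrow> 'a) \<Rightarrow> real" and H :: "'a \<times> (nat \<Rightarrow> 'a) \<Rightarrow> real"
  assumes D: "prob_space D"
    and G[measurable]: "G \<in> borel_measurable (PiM UNIV (\<lambda>_::nat. D))"
    and H[measurable]: "H \<in> borel_measurable (D \<Otimes>\<^sub>M PiM UNIV (\<lambda>_::nat. D))"
    and H_eq: "AE w in PiM UNIV (\<lambda>_::nat. D). \<forall>v\<in>space D. H (v, w) = G (case_nat v w)"
  shows "distr (PiM UNIV (\<lambda>_::nat. D)) borel G = distr (D \<Otimes>\<^sub>M PiM UNIV (\<lambda>_::nat. D)) borel H"
proof -
  let ?Pi = "PiM UNIV (\<lambda>_::nat. D)"
  interpret S: sequence_space D
    unfolding sequence_space_def by (rule product_prob_spaceI) (rule D)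
  interpret pair_prob_space D ?Pi
    by (simp add: pair_prob_space_def pair_sigma_finite_def D S.P.prob_space_axioms prob_space_imp_sigma_finite)
  have case_nat_measurable[measurable]: "(\<lambda>p. case_nat (fst p) (snd p)) \<in> measurable (D \<Otimes>\<^sub>M ?Pi) ?Pi"
    by measurable
  have "AE p in D \<Otimes>\<^sub>M ?Pi. H p = G (case_nat (fst p) (snd p))"
  proof (rule AE_pair_measure)
    show "{p \<in> space (D \<Otimes>\<^sub>M ?Pi). H p = G (case_nat (fst p) (snd p))} \<in> sets (D \<Otimes>\<^sub>M ?Pi)"
      by (rule measurable_equality_set) measurable
    show "AE v in D. AE w in ?Pi. H (v, w) = G (case_nat (fst (v, w)) (snd (v, w)))"
    proof (rule AE_I2)
      fix v assume "v \<in> space D"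
      from H_eq show "AE w in ?Pi. H (v, w) = G (case_nat (fst (v, w)) (snd (v, w)))"
        by eventually_elim (use \<open>v \<in> space D\<close> in auto)
    qed
  qed
  then have "distr (D \<Otimes>\<^sub>M ?Pi) borel H
      = distr (D \<Otimes>\<^sub>M ?Pi) borel (G \<circ> (\<lambda>p. case_nat (fst p) (snd p)))"
    by (intro distr_cong_AE) auto
  also have "\<dots> = distr (distr (D \<Otimes>\<^sub>M ?Pi) ?Pi (\<lambda>p. case_nat (fst p) (snd p))) borel G"
    by (rule distr_distr[symmetric]) measurable
  also have "distr (D \<Otimes>\<^sub>M ?Pi) ?Pi (\<lambda>p. case_nat (fst p) (snd p)) = ?Pi"
    using S.PiM_iter by (simp add: split_beta')
  finally show ?thesis ..
qed

lemma GK_measurable[measurable]: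
  fixes f :: "'a \<Rightarrow> real^'n" and g :: "'a \<Rightarrow> nat \<Rightarrow> real^'n"
  assumes [measurable]: "f \<in> borel_measurable M" "\<And>k. (\<lambda>x. g x k) \<in> borel_measurable M"
  shows "(\<lambda>x. GK P L \<gamma> (f x) (g x)) \<in> borel_measurable M"
proof -
  have [measurable]: "(\<lambda>x. X *v h x) \<in> borel_measurable M" if [measurable]: "h \<in> borel_measurable M"
    for X :: "real^'n^'n" and h
    using borel_measurable_continuous_onI[OF linear_continuous_on[OF matrix_vector_mul_bounded_linear]]
    by measurable
  show ?thesis
    unfolding GK_def by measurable
qed

theorem theorem1:
  fixes A :: "real^'n^'n" and B :: "real^'p^'n" and K :: "real^'n^'p"
    and Q :: "real^'n^'n" and R :: "real^'p^'p" and P :: "real^'n^'n"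
    and \<gamma> :: real and D :: "(real^'n) measure" and x :: "real^'n"
  assumes D_prob: "prob_space D" and D_borel: "sets D = sets borel"
    and D_moments: "\<And>m::nat. integrable D (\<lambda>v. norm v ^ m)"
    and Q_pd: "pos_def Q" and R_pd: "pos_def R"
    and \<gamma>_pos: "0 < \<gamma>" and \<gamma>_lt1: "\<gamma> < 1"
    and stab: "stable (A + B ** K)"
    and lyap: "P = Q + transpose K ** R ** K
                   + \<gamma> *\<^sub>R (transpose (A + B ** K) ** P ** (A + B ** K))"
  shows "distr (PiM UNIV (\<lambda>_::nat. D)) borel (GK P (A + B ** K) \<gamma> x)
       = distr (D \<Otimes>\<^sub>M PiM UNIV (\<lambda>_::nat. D)) borel
           (\<lambda>(v, w). x \<bullet> ((Q + transpose K ** R ** K) *v x)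
                     + \<gamma> * GK P (A + B ** K) \<gamma> ((A + B ** K) *v x + v) w)"
proof -
  define L where "L = A + B ** K"
  define QK where "QK = Q + transpose K ** R ** K"
  have lyap_L: "P = QK + \<gamma> *\<^sub>R (transpose L ** P ** L)"
    using lyap by (simp add: L_def QK_def)
  have "transpose QK = QK"
    using Q_pd R_pd by (simp add: QK_def pos_def_def transpose_add matrix_transpose_mul matrix_mul_assoc)
  obtain C where "0 \<le> C" and L_bounded: "\<And>k y. norm (matpow L k *v y) \<le> C * norm y"
    using stable_matpow_bounded stab unfolding L_def by blast
  obtain \<rho> where \<rho>: "1 < \<rho>" "\<gamma> * \<rho>^2 < 1"
    using ex_gt_1_mult_power2_lt_1 \<gamma>_lt1 by blast
  have "AE w in PiM UNIV (\<lambda>_::nat. D). \<exists>c. \<forall>k. norm (w k) \<le> c * \<rho>^k"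
    using AE_PiM_norm_le_geometric[OF D_prob _ \<open>1 < \<rho>\<close>] D_moments[of 1] by simp
  then have "AE w in PiM UNIV (\<lambda>_::nat. D). \<forall>v\<in>space D.
      x \<bullet> (QK *v x) + \<gamma> * GK P L \<gamma> (L *v x + v) w = GK P L \<gamma> x (case_nat v w)"
  proof eventually_elim
    case (elim w)
    then obtain c where "\<And>k. norm (w k) \<le> c * \<rho>^k" by blast
    from GK_case_nat_geometric_growth[OF less_imp_le[OF \<gamma>_pos] less_imp_le[OF \<rho>(1)] \<rho>(2)
        \<open>0 \<le> C\<close> L_bounded this lyap_L \<open>transpose QK = QK\<close>]
    show ?case by simp
  qed
  moreover have [measurable]:
      "(\<lambda>v. v) \<in> borel_measurable D" "(\<lambda>w. w k) \<in> borel_measurable (PiM UNIV (\<lambda>_. D))" for k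
    using D_borel by (auto simp: measurable_cong_sets[OF refl D_borel, symmetric] measurable_ident_sets)
  ultimately show ?thesis
    unfolding L_def[symmetric] QK_def[symmetric]
    by (intro distr_PiM_eq_distr_case_nat[OF D_prob]) (auto simp: split_beta')
qed

end
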